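(* Let $(s_k)_{k\ge1}$ be a sequence of positive integers. The class $\mathcal{C}^{(s_k)}$ consists precisely of those permutations $\pi$ that can be expressed as $$\pi=\psi^\circ_{v_1}\boxplus\psi^\bullet_{v_2}\boxplus\cdots\boxplus\psi^\bullet_{v_\ell}$$ for some words $v_1,v_2,\dots,v_\ell\in\mathcal{P}^{(s_k)}$ with $|v_1|+|v_2|+\cdots+|v_\ell|=|\pi|$.
   Context: Permutations are in one-line notation; $\pi$ contains $\sigma$ if $\pi$ has a subsequence order-isomorphic to $\sigma$. A finite point set in the plane with distinct coordinates is order-isomorphic to a unique permutation. A factor of a word is a contiguous subword. Binary words: the complement of $\gamma_1\cdots\gamma_n$ is $(1-\gamma_1)\cdots(1-\gamma_n)$. For a sequence $(s_k)$ of positive integers set $\alpha^{(s_k)}_1=01$ and $\alpha^{(s_k)}_{i+1}=(\alpha^{(s_k)}_i)^{s_i}(\overline{\alpha}^{(s_k)}_i)^{s_i}$; $\mathcal{L}^{(s_k)}$ is the set of factors (including the empty word) of the words $\alpha^{(s_k)}_i$, $i\ge1$. Words over $\{\mathsf{u},\mathsf{d},\mathsf{r_u},\mathsf{r_d}\}$: $\rho$ is the morphism $0\mapsto\mathsf{d}\mathsf{r_d}$, $1\mapsto\mathsf{u}\mathsf{r_u}$; $\mathcal{P}$ is the set of all factors (including the empty word $\varepsilon$) of words $\rho(x)$, $x\in\{0,1\}^*$; $\mathcal{P}^{(s_k)}$ is the set of factors of words $\rho(x)$, $x\in\mathcal{L}^{(s_k)}$. For $w=w(1)\cdots w(n)\in\mathcal{P}$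 define points $p_0,\dots,p_n$ with distinct coordinates: $p_0$ (the origin) arbitrary; $p_1$ to the right of and above $p_0$ if $w(1)\in\{\mathsf{u},\mathsf{r_u}\}$, to the right of and below $p_0$ if $w(1)\in\{\mathsf{d},\mathsf{r_d}\}$; for $i\ge2$, $p_i$ lies outside the rectangular hull of $\{p_0,\dots,p_{i-1}\}$ and horizontally or vertically between $p_{i-1}$ and the rectangular hull of $\{p_0,\dots,p_{i-2}\}$, above that hull if $w(i)=\mathsf{u}$, below if $w(i)=\mathsf{d}$, to its right if $w(i)\in\{\mathsf{r_u},\mathsf{r_d}\}$. $\psi^\circ_w$ is the permutation order-isomorphic to $\{p_1,\dots,p_n\}$ and $\psi^\bullet_w$ the one order-isomorphic to $\{p_0,\dots,p_n\}$ (so $\psi^\circ_\varepsilon$ is empty and $\psi^\bullet_\varepsilon=1$). $\mathcal{C}^{(s_k)}$ is the set of all permutations contained in $\psi^\circ_w$ for some $w\in\mathcal{P}^{(s_k)}$. For $\sigma$ of length $m\ge0$ and $\tau$ of length $n+1\ge1$, $\sigma\boxplus\tau$ is the permutation of length $m+n$ obtained by inflating the first entry of $\tau$ by $\sigma$: $(\sigma\boxplus\tau)(i)=\sigma(i)+\tau(1)-1$ for $1\le i\le m$; for $m<i\le m+n$, $(\sigma\boxplus\tau)(i)=\tau(i-m+1)$ if $\tau(i-m+1)<\tau(1)$ and $\tau(i-m+1)+m-1$ otherwise. $\boxplus$ is associative. *)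

theory Defs
  imports Complex_Main "HOL-Library.Sublist"
begin

text \<open>One-line notation: the list \<open>\<pi>\<close> has entries \<open>\<pi>(1), \<dots>, \<pi>(n)\<close>, so \<open>\<pi>(i)\<close> is \<open>\<pi> ! (i - 1)\<close>.\<close>

definition is_perm :: "nat list \<Rightarrow> bool" where
  "is_perm \<pi> \<longleftrightarrow> distinct \<pi> \<and> set \<pi> = {1..length \<pi>}"

definition order_iso :: "nat list \<Rightarrow> nat list \<Rightarrow> bool" where
  "order_iso xs ys \<longleftrightarrow> length xs = length ys \<and>
     (\<forall>i<length xs. \<forall>j<length xs. xs ! i < xs ! j \<longleftrightarrow> ys ! i < ys ! j)"

definition contains :: "nat list \<Rightarrow> nat list \<Rightarrow> bool" where
  "contains \<pi> \<sigma> \<longleftrightarrow> (\<exists>xs. subseq xs \<pi> \<and> order_iso xs \<sigma>)"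

type_synonym point = "real \<times> real"

definition plot :: "nat list \<Rightarrow> point set" where
  "plot \<pi> = {(real i, real (\<pi> ! (i - 1))) | i. i \<in> {1..length \<pi>}}"

definition order_iso_points :: "point set \<Rightarrow> point set \<Rightarrow> bool" where
  "order_iso_points S T \<longleftrightarrow> (\<exists>f. bij_betw f S T \<and>
     (\<forall>p\<in>S. \<forall>q\<in>S. (fst p < fst q \<longleftrightarrow> fst (f p) < fst (f q)) \<and>
                    (snd p < snd q \<longleftrightarrow> snd (f p) < snd (f q))))"

definition rect_hull :: "point set \<Rightarrow> point set" where
  "rect_hull S = {Min (fst ` S)..Max (fst ` S)} \<times> {Min (snd ` S)..Max (snd ` S)}"

text \<open>The letters 0 and 1 are \<^const>\<open>False\<close> and \<^const>\<open>True\<close>.\<close>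

definition complement :: "bool list \<Rightarrow> bool list" where
  "complement x = map Not x"

definition word_power :: "'a list \<Rightarrow> nat \<Rightarrow> 'a list" where
  "word_power x n = concat (replicate n x)"

text \<open>Sequences \<open>s\<close> are indexed from 1; \<open>s 0\<close> and \<open>alpha s 0\<close> are not used.\<close>

fun alpha :: "(nat \<Rightarrow> nat) \<Rightarrow> nat \<Rightarrow> bool list" where
  "alpha s 0 = []"
| "alpha s (Suc 0) = [False, True]"
| "alpha s (Suc (Suc i)) =
     word_power (alpha s (Suc i)) (s (Suc i)) @
     word_power (complement (alpha s (Suc i))) (s (Suc i))"

definition lang_L :: "(nat \<Rightarrow> nat) \<Rightarrow> bool list set" where
  "lang_L s = {x. \<exists>i\<ge>1. sublist x (alpha s i)}"

datatype pin = U | D | RU | RD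

definition rho :: "bool list \<Rightarrow> pin list" where
  "rho x = concat (map (\<lambda>b. if b then [U, RU] else [D, RD]) x)"

definition lang_P :: "(nat \<Rightarrow> nat) \<Rightarrow> pin list set" where
  "lang_P s = {w. \<exists>x\<in>lang_L s. sublist w (rho x)}"

definition between :: "(point \<Rightarrow> real) \<Rightarrow> point \<Rightarrow> point \<Rightarrow> point set \<Rightarrow> bool" where
  "between c q p H \<longleftrightarrow>
     (\<forall>h\<in>H. c h < c q \<and> c q < c p) \<or> (\<forall>h\<in>H. c p < c q \<and> c q < c h)"

definition in_direction :: "pin \<Rightarrow> point \<Rightarrow> point set \<Rightarrow> bool" where
  "in_direction a q H \<longleftrightarrow>
     (case a of
        U \<Rightarrow> (\<forall>h\<in>H. snd h < snd q)
      | D \<Rightarrow> (\<forall>h\<in>H. snd q < snd h)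
      | _ \<Rightarrow> (\<forall>h\<in>H. fst h < fst q))"

text \<open>
  The points are \<open>p 0, \<dots>, p (length w)\<close>, other values of \<open>p\<close> being irrelevant; the letter \<open>w(i)\<close>
  placing \<open>p i\<close> is \<open>w ! (i - 1)\<close>. The side conditions above/below/to the right refer to the hull
  of all earlier points \<open>p 0, \<dots>, p (i - 1)\<close>. The order type of the points is only determined
  by \<open>w\<close> when \<open>w\<close> is a factor of some \<open>rho x\<close>.
\<close>

definition pin_sequence :: "pin list \<Rightarrow> (nat \<Rightarrow> point) \<Rightarrow> bool" where
  "pin_sequence w p \<longleftrightarrow>
     inj_on (\<lambda>i. fst (p i)) {0..length w} \<and> inj_on (\<lambda>i. snd (p i)) {0..length w} \<and>
     (w \<noteq> [] \<longrightarrow> fst (p 0) < fst (p 1) \<and>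
        (if w ! 0 \<in> {U, RU} then snd (p 0) < snd (p 1) else snd (p 1) < snd (p 0))) \<and>
     (\<forall>i\<in>{2..length w}.
        p i \<notin> rect_hull (p ` {0..i - 1}) \<and>
        (between fst (p i) (p (i - 1)) (rect_hull (p ` {0..i - 2})) \<or>
         between snd (p i) (p (i - 1)) (rect_hull (p ` {0..i - 2}))) \<and>
        in_direction (w ! (i - 1)) (p i) (rect_hull (p ` {0..i - 1})))"

definition psi_circ :: "pin list \<Rightarrow> nat list" where
  "psi_circ w = (THE \<pi>. is_perm \<pi> \<and>
     (\<exists>p. pin_sequence w p \<and> order_iso_points (p ` {1..length w}) (plot \<pi>)))"

definition psi_bullet :: "pin list \<Rightarrow> nat list" where
  "psi_bullet w = (THE \<pi>. is_perm \<pi> \<and>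
     (\<exists>p. pin_sequence w p \<and> order_iso_points (p ` {0..length w}) (plot \<pi>)))"

definition class_C :: "(nat \<Rightarrow> nat) \<Rightarrow> nat list set" where
  "class_C s = {\<pi>. is_perm \<pi> \<and> (\<exists>w\<in>lang_P s. contains (psi_circ w) \<pi>)}"

text \<open>Inflation of the first entry of the nonempty permutation \<open>\<tau>\<close> by \<open>\<sigma>\<close>. The truncated
  subtractions are harmless: \<open>hd \<tau> \<ge> 1\<close>, and \<open>y > hd \<tau>\<close> in the last branch.\<close>

definition boxplus :: "nat list \<Rightarrow> nat list \<Rightarrow> nat list" (infixl "\<boxplus>" 65) where
  "\<sigma> \<boxplus> \<tau> = map (\<lambda>x. x + hd \<tau> - 1) \<sigma> @
     map (\<lambda>y. if y < hd \<tau> then y else y + length \<sigma> - 1) (tl \<tau>)"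

end

theory Submission
  imports Defs
begin

text \<open>
  In a pin sequence the point \<open>p j\<close> separates \<open>p (j - 1)\<close> from all earlier points and does not separate
  those from each other. Choose a subset of the points and cut its indices into maximal runs of
  consecutive integers. The first point of a run does not cut the points of the previous runs, nor does
  any later one, so these points form a block playing the role of the origin of the run: the chosen
  points are order-isomorphic to the \<open>\<boxplus>\<close>-sum over the runs. Conversely, since \<open>\<alpha>\<^sub>i\<^sub>+\<^sub>2\<close> has the form
  \<open>\<alpha>\<^sub>i y \<alpha>\<^sub>i\<close> with \<open>y\<close> nonempty, any words of the language occur in a common longer one, in the given
  order and separated by gaps.
\<close>

subsection \<open>Permutations drawn by coordinate functions\<close>

text \<open>
  Coordinates are kept as functions on an index set, so that deleting points and shifting factors do not
  require transporting point sets.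
\<close>

definition draws :: "nat list \<Rightarrow> 'a set \<Rightarrow> ('a \<Rightarrow> 'b::linorder) \<Rightarrow> ('a \<Rightarrow> 'c::linorder) \<Rightarrow> bool" where
  "draws \<pi> S X Y \<longleftrightarrow> is_perm \<pi> \<and> (\<exists>f. bij_betw f S {..<length \<pi>} \<and>
     (\<forall>i\<in>S. \<forall>j\<in>S. (X i < X j \<longleftrightarrow> f i < f j) \<and> (Y i < Y j \<longleftrightarrow> \<pi> ! f i < \<pi> ! f j)))"

section \<open>Ranks and uniqueness of the drawn permutation\<close>

definition rank :: "'a set \<Rightarrow> ('a \<Rightarrow> 'b::linorder) \<Rightarrow> 'a \<Rightarrow> nat" where
  "rank S X i = card {j\<in>S. X j < X i}"

lemma rank_less_iff:
  assumes "finite S" "i \<in> S" "j \<in> S"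
  shows "rank S X i < rank S X j \<longleftrightarrow> X i < X j"
proof -
  have less: "rank S X a < rank S X b" if "X a < X b" "a \<in> S" for a b
    unfolding rank_def using assms(1) that by (intro psubset_card_mono) auto
  have le: "rank S X a \<le> rank S X b" if "X a \<le> X b" for a b
    unfolding rank_def using assms(1) that by (intro card_mono) auto
  show ?thesis
    using less[of i j] le[of j i] assms by (meson not_le)
qed

lemma bij_betw_rank:
  assumes "finite S" "inj_on X S"
  shows "bij_betw (rank S X) S {..<card S}"
proof -
  have inj: "inj_on (rank S X) S"
  proof (rule inj_onI)
    fix i j assume ij: "i \<in> S" "j \<in> S" "rank S X i = rank S X j"
    then have "X i = X j"
      using rank_less_iff[OF assms(1), of i j X] rank_less_iff[OF assms(1), of j i X]
      by (metis less_irrefl neqE)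
    then show "i = j" using assms(2) ij by (meson inj_onD)
  qed
  have sub: "rank S X ` S \<subseteq> {..<card S}"
    unfolding rank_def using assms(1) by (auto intro!: psubset_card_mono)
  show ?thesis
    unfolding bij_betw_def using inj sub
    by (metis card_image card_lessThan card_subset_eq finite_lessThan)
qed

text \<open>Standardisation: index \<open>i\<close> goes to position \<open>rank S X i\<close> and
  receives the entry \<open>Suc (rank S Y i)\<close>; the \<open>Suc\<close> is there because
  positions start at 0 and entries at 1.\<close>

lemma draws_exists:
  assumes "finite S" "inj_on X S" "inj_on Y S"
  shows "\<exists>\<pi>. draws \<pi> S X Y"
proof -
  let ?f = "rank S X"
  let ?g = "inv_into S ?f"
  have f: "bij_betw ?f S {..<card S}" and r: "bij_betw (rank S Y) S {..<card S}"
    using assms bij_betw_rank by auto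
  have g: "bij_betw ?g {..<card S} S" using f by (rule bij_betw_inv_into)
  define \<pi> where "\<pi> = map (\<lambda>k. Suc (rank S Y (?g k))) [0..<card S]"
  have gf: "?g (?f i) = i" if "i \<in> S" for i
    using f that by (simp add: bij_betw_inv_into_left)
  have lt: "?f i < card S" if "i \<in> S" for i
    using f that by (auto simp: bij_betw_def)
  have nth: "\<pi> ! ?f i = Suc (rank S Y i)" if "i \<in> S" for i
    unfolding \<pi>_def using lt that gf by simp
  have rg: "bij_betw (\<lambda>k. rank S Y (?g k)) {..<card S} {..<card S}"
    using bij_betw_trans[OF g r] by (simp add: comp_def)
  have "distinct \<pi>"
    unfolding \<pi>_def distinct_map using bij_betw_imp_inj_on[OF rg]
    by (auto simp: inj_on_def)
  moreover have "set \<pi> = Suc ` ((\<lambda>k. rank S Y (?g k)) ` {..<card S})"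
    unfolding \<pi>_def by (auto simp: atLeast0LessThan)
  then have "set \<pi> = {1..length \<pi>}"
    using bij_betw_imp_surj_on[OF rg]
    by (simp add: \<pi>_def image_Suc_lessThan)
  ultimately have "is_perm \<pi>" by (simp add: is_perm_def)
  moreover have "length \<pi> = card S" by (simp add: \<pi>_def)
  ultimately show ?thesis
    unfolding draws_def using f nth assms(1) by (metis Suc_less_eq rank_less_iff)
qed

text \<open>The entries below \<open>\<pi> ! k\<close> are exactly the numbers from 1 to
  \<open>\<pi> ! k - 1\<close>, so counting them recovers the entry.\<close>

lemma perm_nth_eq_rank:
  assumes "is_perm \<pi>" "k < length \<pi>"
  shows "\<pi> ! k = Suc (rank {..<length \<pi>} ((!) \<pi>) k)"
proof -
  have d: "distinct \<pi>" and s: "set \<pi> = {1..length \<pi>}" using assms(1) by (auto simp: is_perm_def)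
  have "(!) \<pi> ` {l\<in>{..<length \<pi>}. \<pi> ! l < \<pi> ! k} = {x \<in> set \<pi>. x < \<pi> ! k}"
    by (auto simp: set_conv_nth)
  moreover have "\<pi> ! k \<in> {1..length \<pi>}" using assms s nth_mem by metis
  then have "{x \<in> set \<pi>. x < \<pi> ! k} = {1..<\<pi> ! k}" using s by auto
  moreover have "inj_on ((!) \<pi>) {l\<in>{..<length \<pi>}. \<pi> ! l < \<pi> ! k}"
    using d by (auto simp: inj_on_def nth_eq_iff_index_eq)
  ultimately have "card {l\<in>{..<length \<pi>}. \<pi> ! l < \<pi> ! k} = card {1..<\<pi> ! k}"
    by (simp flip: card_image)
  then have "rank {..<length \<pi>} ((!) \<pi>) k = \<pi> ! k - 1"
    by (simp add: rank_def)
  then show ?thesis using \<open>\<pi> ! k \<in> _\<close> by auto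
qed

lemma rank_bij_betw:
  assumes "bij_betw f S T" "\<And>i j. i \<in> S \<Longrightarrow> j \<in> S \<Longrightarrow> X i < X j \<longleftrightarrow> X' (f i) < X' (f j)" "i \<in> S"
  shows "rank S X i = rank T X' (f i)"
proof -
  have img: "f ` {j\<in>S. X j < X i} = {j\<in>T. X' j < X' (f i)}"
    using assms by (auto simp: bij_betw_def)
  have "inj_on f {j\<in>S. X j < X i}"
    using assms(1) by (auto simp: bij_betw_def inj_on_def)
  then show ?thesis unfolding rank_def img[symmetric] by (simp add: card_image)
qed

text \<open>Ranks are invariant under order-preserving bijections. Hence position and entry of
  \<open>i\<close> are forced by \<open>X\<close> and \<open>Y\<close> alone, which gives
  uniqueness.\<close>

lemma draws_nth_rank:
  assumes "draws \<pi> S X Y" "i \<in> S"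
  shows "\<pi> ! rank S X i = Suc (rank S Y i)"
proof -
  obtain f where p: "is_perm \<pi>" and f: "bij_betw f S {..<length \<pi>}"
    and X: "\<And>i j. i \<in> S \<Longrightarrow> j \<in> S \<Longrightarrow> X i < X j \<longleftrightarrow> f i < f j"
    and Y: "\<And>i j. i \<in> S \<Longrightarrow> j \<in> S \<Longrightarrow> Y i < Y j \<longleftrightarrow> \<pi> ! f i < \<pi> ! f j"
    using assms(1) unfolding draws_def by blast
  have fi: "f i < length \<pi>" using f assms(2) by (auto simp: bij_betw_def)
  have "rank S X i = rank {..<length \<pi>} id (f i)"
    using rank_bij_betw[OF f, of X id] X assms(2) by simp
  also have "\<dots> = card {..<f i}"
    unfolding rank_def using fi by (intro arg_cong[where f = card]) auto
  finally have fr: "rank S X i = f i" by simp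
  have "rank S Y i = rank {..<length \<pi>} ((!) \<pi>) (f i)"
    using rank_bij_betw[OF f, of Y "(!) \<pi>"] Y assms(2) by simp
  then show ?thesis
    using fr fi perm_nth_eq_rank[OF p fi] by auto
qed

lemma length_draws:
  assumes "draws \<pi> S X Y"
  shows "length \<pi> = card S"
  using assms unfolding draws_def by (metis bij_betw_same_card card_lessThan)

lemma draws_perm: "draws \<pi> S X Y \<Longrightarrow> is_perm \<pi>"
  by (simp add: draws_def)

lemma draws_inj:
  assumes "draws \<pi> S X Y"
  shows "inj_on X S" "inj_on Y S"
proof -
  obtain f where p: "is_perm \<pi>" and f: "bij_betw f S {..<length \<pi>}"
    and X: "\<And>i j. i \<in> S \<Longrightarrow> j \<in> S \<Longrightarrow> X i < X j \<longleftrightarrow> f i < f j"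
    and Y: "\<And>i j. i \<in> S \<Longrightarrow> j \<in> S \<Longrightarrow> Y i < Y j \<longleftrightarrow> \<pi> ! f i < \<pi> ! f j"
    using assms(1) unfolding draws_def by blast
  have lt: "f i < length \<pi>" if "i \<in> S" for i using f that by (auto simp: bij_betw_def)
  have inj: "i = j" if "i \<in> S" "j \<in> S" "f i = f j" for i j
    using f that by (auto simp: bij_betw_def inj_on_def)
  show "inj_on X S"
    by (rule inj_onI) (metis X inj less_irrefl neqE)
  show "inj_on Y S"
  proof (rule inj_onI)
    fix i j assume ij: "i \<in> S" "j \<in> S" "Y i = Y j"
    then have "\<pi> ! f i = \<pi> ! f j" using Y by (metis less_irrefl neqE)
    then show "i = j" using p ij lt inj by (metis is_perm_def nth_eq_iff_index_eq)
  qed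
qed

lemma draws_unique:
  assumes "draws \<pi> S X Y" "draws \<pi>' S X Y" "finite S"
  shows "\<pi> = \<pi>'"
proof (rule nth_equalityI)
  show "length \<pi> = length \<pi>'" using assms length_draws by metis
  fix k assume "k < length \<pi>"
  then have "k \<in> rank S X ` S"
    using bij_betw_rank[OF assms(3) draws_inj(1)[OF assms(1)]] length_draws[OF assms(1)]
    by (simp add: bij_betw_def)
  then obtain i where "i \<in> S" "k = rank S X i" by blast
  then show "\<pi> ! k = \<pi>' ! k"
    using draws_nth_rank[OF assms(1)] draws_nth_rank[OF assms(2)] by simp
qed

text \<open>Only comparisons enter \<open>draws\<close>, so indices may be renamed and coordinates
  replaced, even by coordinates in another ordered type.\<close>

lemma draws_reindex:
  assumes "draws \<pi> S X Y" "bij_betw g T S"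
    "\<And>i j. i \<in> T \<Longrightarrow> j \<in> T \<Longrightarrow> (X' i < X' j \<longleftrightarrow> X (g i) < X (g j)) \<and> (Y' i < Y' j \<longleftrightarrow> Y (g i) < Y (g j))"
  shows "draws \<pi> T X' Y'"
proof -
  obtain f where p: "is_perm \<pi>" and f: "bij_betw f S {..<length \<pi>}"
    and XY: "\<And>i j. i \<in> S \<Longrightarrow> j \<in> S \<Longrightarrow> (X i < X j \<longleftrightarrow> f i < f j) \<and> (Y i < Y j \<longleftrightarrow> \<pi> ! f i < \<pi> ! f j)"
    using assms(1) unfolding draws_def by blast
  have "bij_betw (f \<circ> g) T {..<length \<pi>}" using assms(2) f by (rule bij_betw_trans)
  moreover have "g i \<in> S" if "i \<in> T" for i using assms(2) that by (auto simp: bij_betw_def)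
  ultimately show ?thesis
    unfolding draws_def using p XY assms(3) by (intro conjI exI[of _ "f \<circ> g"]) auto
qed

lemma draws_cong:
  assumes "draws \<pi> S X Y" "\<And>i. i \<in> S \<Longrightarrow> X' i = X i \<and> Y' i = Y i"
  shows "draws \<pi> S X' Y'"
  using draws_reindex[OF assms(1), of id S X' Y'] assms(2) by simp

text \<open>Distinct abscissae make \<open>p\<close> injective on \<open>S\<close>, so passing from
  indices to the bare point set loses nothing.\<close>

lemma order_iso_points_plot_iff:
  assumes "is_perm \<pi>" "inj_on (\<lambda>i. fst (p i)) S"
  shows "order_iso_points (p ` S) (plot \<pi>) \<longleftrightarrow> draws \<pi> S (\<lambda>i. fst (p i)) (\<lambda>i. snd (p i))"
proof
  \<comment> \<open>\<open>q k\<close> is the point of the plot at zero-based position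
    \<open>k\<close>.\<close>
  define q where "q k = (real (Suc k), real (\<pi> ! k))" for k
  have plot: "plot \<pi> = q ` {..<length \<pi>}"
  proof -
    have "plot \<pi> = (\<lambda>i. (real i, real (\<pi> ! (i - 1)))) ` Suc ` {..<length \<pi>}"
      unfolding plot_def image_Suc_lessThan by auto
    then show ?thesis by (simp add: image_image q_def)
  qed
  have q: "bij_betw q {..<length \<pi>} (plot \<pi>)"
    unfolding plot by (auto simp: bij_betw_def inj_on_def q_def)
  have p: "bij_betw p S (p ` S)"
    using assms(2) by (auto simp: bij_betw_def inj_on_def)
  {
    assume "order_iso_points (p ` S) (plot \<pi>)"
    then obtain f where f: "bij_betw f (p ` S) (plot \<pi>)"
      and fo: "\<forall>a\<in>p ` S. \<forall>b\<in>p ` S. (fst a < fst b \<longleftrightarrow> fst (f a) < fst (f b)) \<and>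
                    (snd a < snd b \<longleftrightarrow> snd (f a) < snd (f b))"
      unfolding order_iso_points_def by blast
    have "draws \<pi> (plot \<pi>) fst snd"
      unfolding draws_def
    proof (intro conjI exI ballI)
      show "is_perm \<pi>" by fact
      show "bij_betw (inv_into {..<length \<pi>} q) (plot \<pi>) {..<length \<pi>}"
        using q by (rule bij_betw_inv_into)
      fix a b assume "a \<in> plot \<pi>" "b \<in> plot \<pi>"
      then obtain k l where "k < length \<pi>" "l < length \<pi>" "a = q k" "b = q l"
        unfolding plot by auto
      moreover from this have "inv_into {..<length \<pi>} q a = k" "inv_into {..<length \<pi>} q b = l"
        using q by (simp_all add: bij_betw_inv_into_left)
      ultimately show "fst a < fst b \<longleftrightarrow> inv_into {..<length \<pi>} q a < inv_into {..<length \<pi>} q b"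
        "snd a < snd b \<longleftrightarrow> \<pi> ! inv_into {..<length \<pi>} q a < \<pi> ! inv_into {..<length \<pi>} q b"
        by (simp_all add: q_def)
    qed
    then show "draws \<pi> S (\<lambda>i. fst (p i)) (\<lambda>i. snd (p i))"
      by (rule draws_reindex[OF _ bij_betw_trans[OF p f]]) (use fo in auto)
  }
  assume "draws \<pi> S (\<lambda>i. fst (p i)) (\<lambda>i. snd (p i))"
  then obtain f where f: "bij_betw f S {..<length \<pi>}"
    and fo: "\<forall>i\<in>S. \<forall>j\<in>S. (fst (p i) < fst (p j) \<longleftrightarrow> f i < f j) \<and> (snd (p i) < snd (p j) \<longleftrightarrow> \<pi> ! f i < \<pi> ! f j)"
    unfolding draws_def by blast
  let ?p = "inv_into S p"
  have inv: "?p (p i) = i" if "i \<in> S" for i using p that by (simp add: bij_betw_inv_into_left)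
  have "bij_betw (q \<circ> f \<circ> ?p) (p ` S) (plot \<pi>)"
    using bij_betw_inv_into[OF p] bij_betw_trans[OF f q] by (rule bij_betw_trans)
  then show "order_iso_points (p ` S) (plot \<pi>)"
    unfolding order_iso_points_def
    by (intro exI[of _ "q \<circ> f \<circ> ?p"] conjI) (use fo inv in \<open>auto simp: q_def\<close>)
qed

section \<open>Containment as restriction to a subset of the indices\<close>

lemma subseq_imp_strict_mono:
  assumes "subseq xs ys"
  shows "\<exists>g. strict_mono_on {..<length xs} g \<and> (\<forall>i<length xs. g i < length ys \<and> xs ! i = ys ! g i)"
  using assms
proof induction
  case (list_emb_Nil ys)
  then show ?case by (simp add: strict_mono_on_def)
next
  case (list_emb_Cons xs ys y)
  then obtain g where "strict_mono_on {..<length xs} g" "\<forall>i<length xs. g i < length ys \<and> xs ! i = ys ! g i"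
    by blast
  then show ?case
    by (intro exI[of _ "Suc \<circ> g"]) (auto simp: strict_mono_on_def)
next
  case (list_emb_Cons2 x y xs ys)
  then obtain g where "strict_mono_on {..<length xs} g" "\<forall>i<length xs. g i < length ys \<and> xs ! i = ys ! g i"
    by blast
  then show ?case using list_emb_Cons2(1)
    by (intro exI[of _ "\<lambda>i. case i of 0 \<Rightarrow> 0 | Suc j \<Rightarrow> Suc (g j)"])
      (auto simp: strict_mono_on_def split: nat.split)
qed

lemma subseq_map_nth:
  assumes "strict_mono_on {..<n} g" "\<And>i. i < n \<Longrightarrow> g i < length ys"
  shows "subseq (map (\<lambda>i. ys ! g i) [0..<n]) ys"
  using assms
proof (induction n arbitrary: ys)
  case (Suc n)
  \<comment> \<open>All earlier positions lie before \<open>g n\<close>, so the induction hypothesis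
    applies to this prefix; \<open>ys ! g n\<close> is then appended.\<close>
  let ?zs = "take (g n) ys"
  have g: "g i < g n" if "i < n" for i
    using Suc.prems(1) that by (auto simp: strict_mono_on_def)
  have len: "length ?zs = g n" using Suc.prems(2)[of n] by simp
  have "strict_mono_on {..<n} g" using Suc.prems(1) by (auto simp: strict_mono_on_def)
  then have "subseq (map (\<lambda>i. ?zs ! g i) [0..<n]) ?zs"
    using g len by (intro Suc.IH) auto
  moreover have "map (\<lambda>i. ?zs ! g i) [0..<n] = map (\<lambda>i. ys ! g i) [0..<n]"
    using g by auto
  ultimately have "subseq (map (\<lambda>i. ys ! g i) [0..<n] @ [ys ! g n]) (?zs @ [ys ! g n])"
    by simp
  moreover have "?zs @ [ys ! g n] @ drop (Suc (g n)) ys = ys"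
    using Suc.prems(2)[of n] by (simp add: id_take_nth_drop[symmetric])
  then have "subseq (?zs @ [ys ! g n]) ys"
    by (metis append_assoc subseq_rev_drop_many subseq_order.refl)
  ultimately have "subseq (map (\<lambda>i. ys ! g i) [0..<n] @ [ys ! g n]) ys"
    by (rule subseq_order.trans)
  then show ?case by simp
qed simp

text \<open>The bijection between \<open>S\<close> and the positions of \<open>\<pi>\<close> turns
  an occurrence of \<open>\<sigma>\<close> into a subset of \<open>S\<close>, while the coordinates
  stay the same.\<close>

lemma contains_iff_draws:
  assumes "draws \<pi> S X Y" "is_perm \<sigma>"
  shows "contains \<pi> \<sigma> \<longleftrightarrow> (\<exists>T\<subseteq>S. draws \<sigma> T X Y)"
proof
  obtain f where f: "bij_betw f S {..<length \<pi>}"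
    and XY: "\<And>i j. i \<in> S \<Longrightarrow> j \<in> S \<Longrightarrow> (X i < X j \<longleftrightarrow> f i < f j) \<and> (Y i < Y j \<longleftrightarrow> \<pi> ! f i < \<pi> ! f j)"
    using assms(1) unfolding draws_def by blast
  let ?n = "length \<sigma>"
  {
    assume "contains \<pi> \<sigma>"
    then obtain xs where xs: "subseq xs \<pi>" "order_iso xs \<sigma>" unfolding contains_def by blast
    then have len: "length xs = ?n" by (simp add: order_iso_def)
    then obtain g where g: "strict_mono_on {..<?n} g"
      and gx: "\<And>i. i < ?n \<Longrightarrow> g i < length \<pi> \<and> xs ! i = \<pi> ! g i"
      using subseq_imp_strict_mono[OF xs(1)] by auto
    \<comment> \<open>\<open>?h i\<close> is the index whose point provides the entry at position
      \<open>i\<close> of the occurrence.\<close>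
    let ?h = "inv_into S f \<circ> g"
    have fS: "f ` S = {..<length \<pi>}" using f by (simp add: bij_betw_def)
    have fh: "f (?h i) = g i" "?h i \<in> S" if "i < ?n" for i
      using gx[OF that] fS by (auto simp: f_inv_into_f intro: inv_into_into)
    have "inj_on (f \<circ> ?h) {..<?n}"
      using strict_mono_on_imp_inj_on[OF g] fh by (simp add: inj_on_def)
    then have h: "bij_betw ?h {..<?n} (?h ` {..<?n})"
      by (meson inj_on_imageI2 inj_on_imp_bij_betw)
    have gl: "g i < g j \<longleftrightarrow> i < j" if "i < ?n" "j < ?n" for i j
      using strict_mono_on_less[OF g] that by simp
    have "draws \<sigma> {..<?n} id ((!) \<sigma>)"
      unfolding draws_def using assms(2) by (auto intro!: exI[of _ id])
    then have "draws \<sigma> (?h ` {..<?n}) X Y"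
    proof (rule draws_reindex[OF _ bij_betw_inv_into[OF h]])
      fix a b assume "a \<in> ?h ` {..<?n}" "b \<in> ?h ` {..<?n}"
      then obtain i j where ij: "i < ?n" "j < ?n" "a = ?h i" "b = ?h j" by blast
      then have inv: "inv_into {..<?n} ?h a = i" "inv_into {..<?n} ?h b = j"
        using h by (simp_all add: bij_betw_inv_into_left del: comp_apply)
      have "\<pi> ! g i < \<pi> ! g j \<longleftrightarrow> \<sigma> ! i < \<sigma> ! j"
        using xs(2) gx[OF ij(1)] gx[OF ij(2)] ij(1,2) len unfolding order_iso_def by metis
      then show "(X a < X b \<longleftrightarrow> id (inv_into {..<?n} ?h a) < id (inv_into {..<?n} ?h b)) \<and>
          (Y a < Y b \<longleftrightarrow> \<sigma> ! inv_into {..<?n} ?h a < \<sigma> ! inv_into {..<?n} ?h b)"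
        using XY[of a b] fh ij gl unfolding inv by (simp del: comp_apply)
    qed
    moreover have "?h ` {..<?n} \<subseteq> S" using fh(2) by blast
    ultimately show "\<exists>T\<subseteq>S. draws \<sigma> T X Y" by blast
  }
  assume "\<exists>T\<subseteq>S. draws \<sigma> T X Y"
  then obtain T h where T: "T \<subseteq> S" and h: "bij_betw h T {..<?n}"
    and hXY: "\<And>i j. i \<in> T \<Longrightarrow> j \<in> T \<Longrightarrow> (X i < X j \<longleftrightarrow> h i < h j) \<and> (Y i < Y j \<longleftrightarrow> \<sigma> ! h i < \<sigma> ! h j)"
    unfolding draws_def by blast
  let ?k = "inv_into T h"
  have hk: "h (?k i) = i" "?k i \<in> T" if "i < ?n" for i
    using h that by (auto simp: bij_betw_def f_inv_into_f intro: inv_into_into)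
  have less: "f (?k i) < f (?k j) \<longleftrightarrow> i < j" and val: "\<pi> ! f (?k i) < \<pi> ! f (?k j) \<longleftrightarrow> \<sigma> ! i < \<sigma> ! j"
    if "i < ?n" "j < ?n" for i j
    using XY[of "?k i" "?k j"] hXY[of "?k i" "?k j"] hk that T by auto
  have "subseq (map (\<lambda>i. \<pi> ! f (?k i)) [0..<?n]) \<pi>"
  proof (rule subseq_map_nth)
    show "strict_mono_on {..<?n} (\<lambda>i. f (?k i))" using less by (simp add: strict_mono_on_def)
    show "f (?k i) < length \<pi>" if "i < ?n" for i
      using f hk(2)[OF that] T by (auto simp: bij_betw_def)
  qed
  moreover have "order_iso (map (\<lambda>i. \<pi> ! f (?k i)) [0..<?n]) \<sigma>"
    using val by (simp add: order_iso_def)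
  ultimately show "contains \<pi> \<sigma>" unfolding contains_def by blast
qed

section \<open>Inflation of the first entry\<close>

lemma length_boxplus: "\<tau> \<noteq> [] \<Longrightarrow> length (\<sigma> \<boxplus> \<tau>) = length \<sigma> + length \<tau> - 1"
  by (cases \<tau>) (auto simp: boxplus_def)

text \<open>The values form three adjacent intervals: the entries of \<open>\<tau>\<close> below its
  head, the raised copy of \<open>\<sigma>\<close>, and the raised larger entries of
  \<open>\<tau>\<close>.\<close>

lemma is_perm_boxplus:
  assumes "is_perm \<sigma>" "is_perm \<tau>" "\<tau> \<noteq> []"
  shows "is_perm (\<sigma> \<boxplus> \<tau>)"
proof -
  obtain h t where \<tau>: "\<tau> = h # t" using assms(3) by (cases \<tau>) auto
  let ?m = "length \<sigma>"
  have \<sigma>: "set \<sigma> = {1..?m}" and h: "h \<in> {1..Suc (length t)}"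
    and t: "set t = {1..Suc (length t)} - {h}"
    using assms unfolding is_perm_def \<tau> by auto
  have "set (\<sigma> \<boxplus> \<tau>) = (\<lambda>x. x + h - 1) ` {1..?m} \<union>
      (\<lambda>y. if y < h then y else y + ?m - 1) ` ({1..Suc (length t)} - {h})"
    unfolding boxplus_def \<tau> using \<sigma> t by simp
  also have "\<dots> = {1..?m + length t}"
  proof (intro equalityI subsetI)
    fix x assume x: "x \<in> {1..?m + length t}"
    consider "x < h" | "h \<le> x" "x < h + ?m" | "h + ?m \<le> x" by linarith
    then show "x \<in> (\<lambda>x. x + h - 1) ` {1..?m} \<union>
      (\<lambda>y. if y < h then y else y + ?m - 1) ` ({1..Suc (length t)} - {h})"
    proof cases
      case 1
      then show ?thesis using x h by (intro UnI2 image_eqI[of _ _ x]) auto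
    next
      case 2
      then show ?thesis using x h by (intro UnI1 image_eqI[of _ _ "x + 1 - h"]) auto
    next
      case 3
      then show ?thesis using x h by (intro UnI2 image_eqI[of _ _ "x + 1 - ?m"]) auto
    qed
  qed (use h in \<open>auto split: if_splits\<close>)
  finally have "set (\<sigma> \<boxplus> \<tau>) = {1..length (\<sigma> \<boxplus> \<tau>)}"
    by (simp add: length_boxplus \<tau>)
  \<comment> \<open>The value set has as many elements as the list is long, which forces
    distinctness.\<close>
  then show ?thesis unfolding is_perm_def by (simp add: card_distinct)
qed

text \<open>
  The index \<open>z\<close> plays the role of the first entry of \<open>\<tau>\<close>, which is replaced by the block \<open>A\<close>.
\<close>

lemma draws_boxplus:
  assumes \<sigma>: "draws \<sigma> A X Y" and \<tau>: "draws \<tau> (insert z B) X' Y'"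
    and disj: "A \<inter> B = {}" "z \<notin> B"
    and z: "\<And>b. b \<in> B \<Longrightarrow> X' z < X' b"
    and A: "\<And>a a'. a \<in> A \<Longrightarrow> a' \<in> A \<Longrightarrow> (X'' a < X'' a' \<longleftrightarrow> X a < X a') \<and> (Y'' a < Y'' a' \<longleftrightarrow> Y a < Y a')"
    and B: "\<And>b b'. b \<in> B \<Longrightarrow> b' \<in> B \<Longrightarrow> (X'' b < X'' b' \<longleftrightarrow> X' b < X' b') \<and> (Y'' b < Y'' b' \<longleftrightarrow> Y' b < Y' b')"
    and AB: "\<And>a b. a \<in> A \<Longrightarrow> b \<in> B \<Longrightarrow> X'' a < X'' b \<and> Y'' a \<noteq> Y'' b \<and> (Y'' a < Y'' b \<longleftrightarrow> Y' z < Y' b)"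
  shows "draws (\<sigma> \<boxplus> \<tau>) (A \<union> B) X'' Y''"
proof -
  let ?m = "length \<sigma>"
  obtain f where f: "bij_betw f A {..<?m}"
    and fo: "\<And>i j. i \<in> A \<Longrightarrow> j \<in> A \<Longrightarrow> (X i < X j \<longleftrightarrow> f i < f j) \<and> (Y i < Y j \<longleftrightarrow> \<sigma> ! f i < \<sigma> ! f j)"
    using \<sigma> unfolding draws_def by blast
  obtain g where g: "bij_betw g (insert z B) {..<length \<tau>}"
    and go: "\<And>i j. i \<in> insert z B \<Longrightarrow> j \<in> insert z B \<Longrightarrow>
      (X' i < X' j \<longleftrightarrow> g i < g j) \<and> (Y' i < Y' j \<longleftrightarrow> \<tau> ! g i < \<tau> ! g j)"
    using \<tau> unfolding draws_def by blast
  have gz_lt: "g z < length \<tau>" using g by (auto simp: bij_betw_def)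
  then have ne: "\<tau> \<noteq> []" by auto
  have perm: "is_perm \<sigma>" "is_perm \<tau>" using \<sigma> \<tau> by (auto simp: draws_def)
  \<comment> \<open>\<open>z\<close> has the least abscissa, so it is the first entry of
    \<open>\<tau>\<close>.\<close>
  have gz: "g z = 0"
  proof -
    have "0 \<in> g ` insert z B" using g ne by (auto simp: bij_betw_def)
    then obtain c where "c \<in> insert z B" "g c = 0" by (metis imageE)
    then show ?thesis using go[of z c] z[of c] by auto
  qed
  have f_lt: "f a < ?m" if "a \<in> A" for a using f that by (auto simp: bij_betw_def)
  have g_pos: "0 < g b" "g b < length \<tau>" if "b \<in> B" for b
    using go[of z b] z that gz g by (auto simp: bij_betw_def)
  have gB: "bij_betw g B {0<..<length \<tau>}"
  proof -
    have "bij_betw g (insert z B - {z}) ({..<length \<tau>} - {g z})"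
      using g gz_lt by (intro bij_betw_DiffI) (auto simp: bij_betw_def)
    moreover have "insert z B - {z} = B" "{..<length \<tau>} - {g z} = {0<..<length \<tau>}"
      using disj(2) gz by auto
    ultimately show ?thesis by simp
  qed
  \<comment> \<open>Position 0 of \<open>\<tau>\<close> gives way to the \<open>?m\<close> positions
    of the block. The subtraction is not truncated, as \<open>g\<close> is positive on
    \<open>B\<close>.\<close>
  define k where "k i = (if i \<in> A then f i else g i + ?m - 1)" for i
  have kA: "k a = f a" if "a \<in> A" for a using that by (simp add: k_def)
  have kB: "k b = g b + ?m - 1" if "b \<in> B" for b using that disj by (auto simp: k_def)
  have bij: "bij_betw k (A \<union> B) ({..<?m} \<union> {?m..<?m + length \<tau> - 1})"
  proof (rule bij_betw_combine)
    show "bij_betw k A {..<?m}" using f kA by (simp cong: bij_betw_cong)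
    have "bij_betw (\<lambda>x. x + ?m - 1) {0<..<length \<tau>} {?m..<?m + length \<tau> - 1}"
      by (rule bij_betw_byWitness[where f' = "\<lambda>y. y + 1 - ?m"]) auto
    then have "bij_betw ((\<lambda>x. x + ?m - 1) \<circ> g) B {?m..<?m + length \<tau> - 1}"
      using gB by (rule bij_betw_trans[rotated])
    then show "bij_betw k B {?m..<?m + length \<tau> - 1}"
      using kB by (simp cong: bij_betw_cong)
  qed auto
  have len: "length (\<sigma> \<boxplus> \<tau>) = ?m + length \<tau> - 1" using length_boxplus[OF ne] .
  have bij: "bij_betw k (A \<union> B) {..<length (\<sigma> \<boxplus> \<tau>)}"
  proof -
    have "{..<?m} \<union> {?m..<?m + length \<tau> - 1} = {..<length (\<sigma> \<boxplus> \<tau>)}"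
      unfolding len using ne by (cases \<tau>) auto
    then show ?thesis using bij by simp
  qed
  let ?h = "hd \<tau>"
  have h: "?h = \<tau> ! g z" using gz ne by (simp add: hd_conv_nth)
  have h_pos: "1 \<le> ?h" using perm(2) ne hd_in_set[of \<tau>] by (auto simp: is_perm_def)
  have nthA: "(\<sigma> \<boxplus> \<tau>) ! k a = \<sigma> ! f a + ?h - 1" if "a \<in> A" for a
    using f_lt[OF that] kA[OF that] by (simp add: boxplus_def nth_append)
  have nthB: "(\<sigma> \<boxplus> \<tau>) ! k b = (if \<tau> ! g b < ?h then \<tau> ! g b else \<tau> ! g b + ?m - 1)" if "b \<in> B" for b
    using g_pos[OF that] kB[OF that] by (auto simp: boxplus_def nth_append nth_tl)
  have \<sigma>_val: "\<sigma> ! f a \<in> {1..?m}" if "a \<in> A" for a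
    using perm(1) f_lt[OF that] nth_mem by (fastforce simp: is_perm_def)
  have \<tau>_val: "\<tau> ! g b \<noteq> ?h" if "b \<in> B" for b
    using perm(2) g_pos[OF that] gz h ne by (simp add: is_perm_def nth_eq_iff_index_eq)
  show ?thesis
    unfolding draws_def
  proof (intro conjI exI ballI)
    show "is_perm (\<sigma> \<boxplus> \<tau>)" using perm ne by (rule is_perm_boxplus)
    show "bij_betw k (A \<union> B) {..<length (\<sigma> \<boxplus> \<tau>)}" by (rule bij)
    fix i j assume "i \<in> A \<union> B" "j \<in> A \<union> B"
    then consider "i \<in> A" "j \<in> A" | "i \<in> A" "j \<in> B" | "i \<in> B" "j \<in> A" | "i \<in> B" "j \<in> B" by auto
    then have "(X'' i < X'' j \<longleftrightarrow> k i < k j) \<and> (Y'' i < Y'' j \<longleftrightarrow> (\<sigma> \<boxplus> \<tau>) ! k i < (\<sigma> \<boxplus> \<tau>) ! k j)"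
    proof cases
      case 1
      then show ?thesis using A[of i j] fo[of i j] kA nthA h_pos by auto
    next
      case 2
      then show ?thesis
        using AB[of i j] kA kB nthA nthB \<sigma>_val[of i] \<tau>_val[of j] f_lt[of i] g_pos[of j] h_pos go[of z j] h
        by auto
    next
      case 3
      then show ?thesis
        using AB[of j i] kA kB nthA nthB \<sigma>_val[of j] \<tau>_val[of i] f_lt[of j] g_pos[of i] h_pos go[of z i] h
        by auto
    next
      case 4
      then show ?thesis
        using B[of i j] go[of i j] kB nthB \<tau>_val[of i] \<tau>_val[of j] g_pos[of i] g_pos[of j] h_pos
        by auto
    qed
    then show "X'' i < X'' j \<longleftrightarrow> k i < k j" "Y'' i < Y'' j \<longleftrightarrow> (\<sigma> \<boxplus> \<tau>) ! k i < (\<sigma> \<boxplus> \<tau>) ! k j"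
      by auto
  qed
qed

subsection \<open>The order type of a pin sequence\<close>

definition vertical :: "pin \<Rightarrow> bool" where
  "vertical a \<longleftrightarrow> a \<in> {U, D}"

text \<open>For a right pin this is its subscript: the side of the origin \<open>p 0\<close> on
  which the pin lies.\<close>

definition upward :: "pin \<Rightarrow> bool" where
  "upward a \<longleftrightarrow> a \<in> {U, RU}"

text \<open>A condition on adjacent letters that holds for every factor of a word
  \<open>rho x\<close>. It is all that the geometry below uses about these words.\<close>

definition pin_word :: "pin list \<Rightarrow> bool" where
  "pin_word = successively (\<lambda>a b. vertical a \<noteq> vertical b \<and> (vertical a \<longrightarrow> upward a = upward b))"

lemma pin_wordD:
  assumes "pin_word w" "2 \<le> j" "j \<le> length w"
  shows "vertical (w ! (j - 2)) \<noteq> vertical (w ! (j - 1))"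
    "vertical (w ! (j - 2)) \<Longrightarrow> upward (w ! (j - 2)) = upward (w ! (j - 1))"
proof -
  have "Suc (j - 2) = j - 1" "Suc (j - 2) < length w" using assms by auto
  then show "vertical (w ! (j - 2)) \<noteq> vertical (w ! (j - 1))"
    "vertical (w ! (j - 2)) \<Longrightarrow> upward (w ! (j - 2)) = upward (w ! (j - 1))"
    using assms(1) unfolding pin_word_def successively_conv_nth by metis+
qed

lemma pin_word_sublist: "pin_word w \<Longrightarrow> sublist v w \<Longrightarrow> pin_word v"
  by (auto simp: pin_word_def sublist_def successively_append_iff)

lemma pin_word_rho: "pin_word (rho x)"
proof (induction x)
  case (Cons b x)
  have "rho x = [] \<or> vertical (hd (rho x))"
    by (cases x) (auto simp: rho_def vertical_def)
  then show ?case
    using Cons by (auto simp: pin_word_def rho_def successively_Cons vertical_def upward_def)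
qed (simp add: pin_word_def rho_def)

lemma pin_word_lang_P: "w \<in> lang_P s \<Longrightarrow> pin_word w"
  unfolding lang_P_def using pin_word_rho pin_word_sublist by blast

text \<open>
  The relative position of \<open>p i\<close> and \<open>p j\<close>, \<open>i < j\<close>, in any pin sequence of a pin word: only the
  immediate predecessor of \<open>p j\<close> can lie beyond \<open>p j\<close>, in the direction in which \<open>p j\<close> cuts it off.
\<close>

definition right_of :: "pin list \<Rightarrow> nat \<Rightarrow> nat \<Rightarrow> bool" where
  "right_of w i j \<longleftrightarrow> j = 1 \<or> \<not> vertical (w ! (j - 1)) \<or> Suc i < j"

definition above :: "pin list \<Rightarrow> nat \<Rightarrow> nat \<Rightarrow> bool" where
  "above w i j \<longleftrightarrow> (upward (w ! (j - 1)) \<longleftrightarrow> j = 1 \<or> vertical (w ! (j - 1)) \<or> Suc i < j)"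

definition pin_order :: "pin list \<Rightarrow> (nat \<Rightarrow> 'a::linorder) \<Rightarrow> (nat \<Rightarrow> 'b::linorder) \<Rightarrow> bool" where
  "pin_order w X Y \<longleftrightarrow> (\<forall>j\<le>length w. \<forall>i<j.
     (if right_of w i j then X i < X j else X j < X i) \<and>
     (if above w i j then Y i < Y j else Y j < Y i))"

lemma pin_orderD:
  assumes "pin_order w X Y" "i < j" "j \<le> length w"
  shows "X i < X j \<longleftrightarrow> right_of w i j" "X j < X i \<longleftrightarrow> \<not> right_of w i j"
    "Y i < Y j \<longleftrightarrow> above w i j" "Y j < Y i \<longleftrightarrow> \<not> above w i j"
  using assms unfolding pin_order_def by (metis order.asym)+

text \<open>The word prescribes every comparison, so real points may later be exchanged for integer
  coordinates.\<close>

lemma pin_order_unique: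
  assumes "pin_order w X Y" "pin_order w X' Y'" "i \<le> length w" "j \<le> length w"
  shows "(X i < X j \<longleftrightarrow> X' i < X' j) \<and> (Y i < Y j \<longleftrightarrow> Y' i < Y' j)"
  by (cases i j rule: linorder_cases)
    (use assms in \<open>simp_all add: pin_orderD[OF assms(1)] pin_orderD[OF assms(2)]\<close>)

lemma pin_order_inj:
  assumes "pin_order w X Y"
  shows "inj_on X {0..length w}" "inj_on Y {0..length w}"
proof -
  have "X i \<noteq> X j \<and> Y i \<noteq> Y j" if "i < j" "j \<le> length w" for i j
    using pin_orderD[OF assms that] by (metis less_irrefl)
  then have "X i \<noteq> X j \<and> Y i \<noteq> Y j" if "i \<noteq> j" "i \<le> length w" "j \<le> length w" for i j
    using that by (metis linorder_neqE_nat)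
  then show "inj_on X {0..length w}" "inj_on Y {0..length w}"
    by (auto intro!: inj_onI) metis+
qed

section \<open>Rectangular hulls as coordinate bounds\<close>

lemma mem_rect_hull:
  assumes "finite S" "a \<in> S"
  shows "a \<in> rect_hull S"
  unfolding rect_hull_def mem_Times_iff using assms by auto

text \<open>Every side of the hull passes through a point of \<open>S\<close>, so bounds for
  \<open>S\<close> control the whole hull.\<close>

lemma rect_hull_bounded:
  assumes "h \<in> rect_hull S" "finite S" "S \<noteq> {}"
  shows "\<exists>a\<in>S. fst a \<le> fst h" "\<exists>a\<in>S. fst h \<le> fst a" "\<exists>a\<in>S. snd a \<le> snd h" "\<exists>a\<in>S. snd h \<le> snd a"
proof -
  have "Min (fst ` S) \<in> fst ` S" "Max (fst ` S) \<in> fst ` S" "Min (snd ` S) \<in> snd ` S" "Max (snd ` S) \<in> snd ` S"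
    using assms by (auto intro!: Min_in Max_in)
  moreover have "Min (fst ` S) \<le> fst h" "fst h \<le> Max (fst ` S)" "Min (snd ` S) \<le> snd h" "snd h \<le> Max (snd ` S)"
    using assms(1) by (auto simp: rect_hull_def)
  ultimately show "\<exists>a\<in>S. fst a \<le> fst h" "\<exists>a\<in>S. fst h \<le> fst a" "\<exists>a\<in>S. snd a \<le> snd h" "\<exists>a\<in>S. snd h \<le> snd a"
    by (metis imageE)+
qed

lemma rect_hull_all_less_iff:
  assumes "finite S" "S \<noteq> {}"
  shows "(\<forall>h\<in>rect_hull S. fst h < c) \<longleftrightarrow> (\<forall>a\<in>S. fst a < c)"
    "(\<forall>h\<in>rect_hull S. c < fst h) \<longleftrightarrow> (\<forall>a\<in>S. c < fst a)"
    "(\<forall>h\<in>rect_hull S. snd h < c) \<longleftrightarrow> (\<forall>a\<in>S. snd a < c)"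
    "(\<forall>h\<in>rect_hull S. c < snd h) \<longleftrightarrow> (\<forall>a\<in>S. c < snd a)"
  using rect_hull_bounded[OF _ assms] mem_rect_hull[OF assms(1)] by (meson order.strict_trans1 order.strict_trans2)+

lemma rect_hull_nonempty: "finite S \<Longrightarrow> S \<noteq> {} \<Longrightarrow> rect_hull S \<noteq> {}"
  using mem_rect_hull by blast

text \<open>In \<open>between\<close>, the comparison of \<open>q\<close> with \<open>p\<close>
  stands under the quantifier over the hull; it can be pulled out because the hull is
  nonempty.\<close>

lemma between_fst_iff:
  assumes "finite S" "S \<noteq> {}"
  shows "between fst q p (rect_hull S) \<longleftrightarrow>
    ((\<forall>a\<in>S. fst a < fst q) \<and> fst q < fst p) \<or> (fst p < fst q \<and> (\<forall>a\<in>S. fst q < fst a))"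
  unfolding between_def rect_hull_all_less_iff[OF assms, symmetric]
  using rect_hull_nonempty[OF assms] by blast

lemma between_snd_iff:
  assumes "finite S" "S \<noteq> {}"
  shows "between snd q p (rect_hull S) \<longleftrightarrow>
    ((\<forall>a\<in>S. snd a < snd q) \<and> snd q < snd p) \<or> (snd p < snd q \<and> (\<forall>a\<in>S. snd q < snd a))"
  unfolding between_def rect_hull_all_less_iff[OF assms, symmetric]
  using rect_hull_nonempty[OF assms] by blast

lemma in_direction_iff:
  assumes "finite S" "S \<noteq> {}"
  shows "in_direction a q (rect_hull S) \<longleftrightarrow>
    (if vertical a then if upward a then \<forall>h\<in>S. snd h < snd q else \<forall>h\<in>S. snd q < snd h
     else \<forall>h\<in>S. fst h < fst q)"
  by (cases a) (simp_all add: in_direction_def vertical_def upward_def rect_hull_all_less_iff[OF assms])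

lemma in_direction_notin: "in_direction a q H \<Longrightarrow> q \<notin> H"
  by (cases a) (auto simp: in_direction_def)

text \<open>The letter puts \<open>p j\<close> beyond all earlier points along its own axis, so the
  separation happens along the other axis. Its sense is fixed by \<open>p 0\<close>: the previous
  letter tells on which side of \<open>p 0\<close> the point \<open>p (j - 1)\<close> lies.\<close>

lemma pin_sequence_iff:
  assumes w: "pin_word w"
  shows "pin_sequence w p \<longleftrightarrow> pin_order w (\<lambda>i. fst (p i)) (\<lambda>i. snd (p i))"
proof
  let ?X = "\<lambda>i. fst (p i)" and ?Y = "\<lambda>i. snd (p i)"
  have fin: "finite (p ` {0..k})" "p ` {0..k} \<noteq> {}" for k by auto
  {
    assume p: "pin_sequence w p"
    have first: "?X 0 < ?X 1" "if upward (w ! 0) then ?Y 0 < ?Y 1 else ?Y 1 < ?Y 0" if "w \<noteq> []"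
      using p that unfolding pin_sequence_def upward_def by auto
    have dir: "if vertical (w ! (j - 1))
        then if upward (w ! (j - 1)) then \<forall>i<j. ?Y i < ?Y j else \<forall>i<j. ?Y j < ?Y i
        else \<forall>i<j. ?X i < ?X j" if "2 \<le> j" "j \<le> length w" for j
    proof -
      have "in_direction (w ! (j - 1)) (p j) (rect_hull (p ` {0..j - 1}))"
        using p that unfolding pin_sequence_def by auto
      moreover have "{0..j - 1} = {..<j}" using that by auto
      ultimately show ?thesis unfolding in_direction_iff[OF fin] by (auto split: if_splits)
    qed
    have "(if right_of w i j then ?X i < ?X j else ?X j < ?X i) \<and>
       (if above w i j then ?Y i < ?Y j else ?Y j < ?Y i)" if ij: "i < j" "j \<le> length w" for i j
    proof (cases "j = 1")
      case True
      moreover have "w \<noteq> []" using ij by auto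
      ultimately show ?thesis using first ij unfolding right_of_def above_def by auto
    next
      case False
      then have j: "2 \<le> j" using ij by simp
      have le: "i = j - 1 \<or> i \<in> {0..j - 2}" "Suc i < j \<longleftrightarrow> i \<noteq> j - 1" using ij j by auto
      have zero: "0 \<in> {0..j - 2}" "0 < j" "j - 1 < j" "j - 1 - 1 = j - 2" using j by auto
      \<comment> \<open>For \<open>j = 2\<close> this comes from the special rule for the first pin,
        for larger \<open>j\<close> from \<open>dir\<close>.\<close>
      have prev: "if vertical (w ! (j - 2)) then if upward (w ! (j - 2)) then ?Y 0 < ?Y (j - 1) else ?Y (j - 1) < ?Y 0
          else ?X 0 < ?X (j - 1)"
      proof (cases "j = 2")
        case True
        then have "w \<noteq> []" using ij by auto
        then show ?thesis using first True by auto
      next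
        case False
        then have "2 \<le> j - 1" "j - 1 \<le> length w" "0 < j - 1" using j ij by auto
        then show ?thesis using dir[of "j - 1"] zero by (auto split: if_splits)
      qed
      have "between fst (p j) (p (j - 1)) (rect_hull (p ` {0..j - 2})) \<or>
          between snd (p j) (p (j - 1)) (rect_hull (p ` {0..j - 2}))"
        using p j ij unfolding pin_sequence_def by auto
      then have btw: "((\<forall>i\<in>{0..j - 2}. ?X i < ?X j) \<and> ?X j < ?X (j - 1)) \<or> (?X (j - 1) < ?X j \<and> (\<forall>i\<in>{0..j - 2}. ?X j < ?X i))
        \<or> ((\<forall>i\<in>{0..j - 2}. ?Y i < ?Y j) \<and> ?Y j < ?Y (j - 1)) \<or> (?Y (j - 1) < ?Y j \<and> (\<forall>i\<in>{0..j - 2}. ?Y j < ?Y i))"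
        unfolding between_fst_iff[OF fin] between_snd_iff[OF fin] by (simp only: ball_simps disj_assoc)
      note alt = pin_wordD[OF w j ij(2)]
      show ?thesis
      proof (cases "vertical (w ! (j - 1))")
        case True
        then have "?X 0 < ?X (j - 1)" using alt prev by simp
        \<comment> \<open>Separation in the second coordinate contradicts \<open>dir\<close>, and
          the opposite horizontal order would put \<open>p (j - 1)\<close> to the left of
          \<open>p 0\<close>.\<close>
        then have "(\<forall>i\<in>{0..j - 2}. ?X i < ?X j) \<and> ?X j < ?X (j - 1)"
          using True dir[OF j ij(2)] btw zero by (smt (verit))
        then show ?thesis
          using True dir[OF j ij(2)] le ij False unfolding right_of_def above_def by auto
      next
        case F: False
        \<comment> \<open>The vertical letter before a right pin has the direction of its subscript,
          so the subscript locates \<open>p (j - 1)\<close>.\<close>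
        then have "if upward (w ! (j - 1)) then ?Y 0 < ?Y (j - 1) else ?Y (j - 1) < ?Y 0" using alt prev by simp
        then have "if upward (w ! (j - 1)) then (\<forall>i\<in>{0..j - 2}. ?Y i < ?Y j) \<and> ?Y j < ?Y (j - 1)
            else ?Y (j - 1) < ?Y j \<and> (\<forall>i\<in>{0..j - 2}. ?Y j < ?Y i)"
          using F dir[OF j ij(2)] btw zero by (smt (verit))
        then show ?thesis
          using F dir[OF j ij(2)] le ij False unfolding right_of_def above_def by (auto split: if_splits)
      qed
    qed
    then show "pin_order w ?X ?Y" unfolding pin_order_def by blast
  }
  assume ord: "pin_order w ?X ?Y"
  note D = pin_orderD[OF ord]
  show "pin_sequence w p"
    unfolding pin_sequence_def
  proof (intro conjI impI ballI)
    show "inj_on ?X {0..length w}" "inj_on ?Y {0..length w}" using pin_order_inj[OF ord] .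
    show "?X 0 < ?X 1" if "w \<noteq> []" using that D(1)[of 0 1] by (simp add: right_of_def Suc_le_eq)
    show "if w ! 0 \<in> {U, RU} then ?Y 0 < ?Y 1 else ?Y 1 < ?Y 0" if "w \<noteq> []"
      using that D(3,4)[of 0 1] by (simp add: above_def upward_def Suc_le_eq)
    fix j assume "j \<in> {2..length w}"
    then have j: "2 \<le> j" "j \<le> length w" by auto
    then have le: "i < j" if "i \<le> j - 1" for i using that by simp
    have lt: "i < j" "Suc i < j" if "i \<le> j - 2" for i using that j by auto
    show dir: "in_direction (w ! (j - 1)) (p j) (rect_hull (p ` {0..j - 1}))"
      unfolding in_direction_iff[OF fin]
      using D[OF le j(2)] j(1) by (auto simp: right_of_def above_def)
    then show "p j \<notin> rect_hull (p ` {0..j - 1})" by (rule in_direction_notin)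
    \<comment> \<open>Among the earlier indices only \<open>j - 1\<close> fails
      \<open>Suc i < j\<close>, so it is the one point that \<open>p j\<close> cuts off.\<close>
    have last: "j - 1 < j" "\<not> Suc (j - 1) < j" "j \<noteq> 1" using j by auto
    show "between fst (p j) (p (j - 1)) (rect_hull (p ` {0..j - 2})) \<or>
        between snd (p j) (p (j - 1)) (rect_hull (p ` {0..j - 2}))"
      unfolding between_fst_iff[OF fin] between_snd_iff[OF fin]
      using D[OF lt(1) j(2)] D[OF last(1) j(2)] last lt(2) by (auto simp: right_of_def above_def)
  qed
qed

text \<open>
  Explicit coordinates of a pin sequence. They depend on \<open>i\<close> and the letter placing \<open>p i\<close> only, so that
  passing to a factor of \<open>w\<close> just shifts them; equal coordinates are excluded by parity, because
  vertical and horizontal letters alternate.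
\<close>

definition xkey :: "pin list \<Rightarrow> nat \<Rightarrow> int" where
  "xkey w i = (if i = 0 then 0 else if vertical (w ! (i - 1)) then int i else int i + 2)"

definition ykey :: "pin list \<Rightarrow> nat \<Rightarrow> int" where
  "ykey w i = (if i = 0 then 0 else
     (if upward (w ! (i - 1)) then 1 else -1) * (if vertical (w ! (i - 1)) then int i + 2 else int i))"

text \<open>
  Once an index is skipped, both the abscissa and the distance from the horizontal axis increase. Hence a
  pin whose predecessor is deleted sees all earlier pins as a single point.
\<close>

lemma key_gap:
  assumes w: "pin_word w" and ij: "Suc i < j" "j \<le> length w"
  shows "xkey w i < xkey w j" "\<bar>ykey w i\<bar> < \<bar>ykey w j\<bar>"
proof -
  have "vertical (w ! (j - 1)) = vertical (w ! (i - 1))" if "j = i + 2" "i > 0"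
    using pin_wordD(1)[OF w, of "i + 2"] pin_wordD(1)[OF w, of "i + 1"] ij that by auto
  then show "xkey w i < xkey w j" "\<bar>ykey w i\<bar> < \<bar>ykey w j\<bar>"
    using ij by (cases "j = i + 2"; force simp: xkey_def ykey_def)+
qed

lemma ykey_pos_iff: "0 < i \<Longrightarrow> 0 < ykey w i \<longleftrightarrow> upward (w ! (i - 1))"
  by (auto simp: ykey_def)

text \<open>Nonadjacent indices are ordered by \<open>key_gap\<close> and the sign of
  \<open>ykey\<close>. For adjacent pins, the extra 2 along a pin's own axis puts it one unit beyond
  its successor there.\<close>

lemma pin_order_keys:
  assumes w: "pin_word w"
  shows "pin_order w (xkey w) (ykey w)"
  unfolding pin_order_def
proof (intro allI impI)
  fix i j assume ij: "j \<le> length w" "i < j"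
  consider "j = 1" "i = 0" | "Suc i < j" | "j = Suc i" "0 < i" using ij by linarith
  then show "(if right_of w i j then xkey w i < xkey w j else xkey w j < xkey w i) \<and>
      (if above w i j then ykey w i < ykey w j else ykey w j < ykey w i)"
  proof cases
    case 1
    then show ?thesis by (auto simp: right_of_def above_def xkey_def ykey_def)
  next
    case 2
    then show ?thesis
      using key_gap[OF w 2 ij(1)] ykey_pos_iff[of j w] ij by (auto simp: right_of_def above_def)
  next
    case 3
    then show ?thesis
      using pin_wordD[OF w, of j] ij by (auto simp: right_of_def above_def xkey_def ykey_def)
  qed
qed

text \<open>All pin sequences of \<open>w\<close> have the order type of the keys, and the keys,
  read as reals, form one.\<close>

lemma pin_points_iff_draws:
  assumes w: "pin_word w" and S: "S \<subseteq> {0..length w}"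
  shows "is_perm \<pi> \<and> (\<exists>p. pin_sequence w p \<and> order_iso_points (p ` S) (plot \<pi>)) \<longleftrightarrow>
    draws \<pi> S (xkey w) (ykey w)"
proof
  assume "is_perm \<pi> \<and> (\<exists>p. pin_sequence w p \<and> order_iso_points (p ` S) (plot \<pi>))"
  then obtain p where \<pi>: "is_perm \<pi>" and p: "pin_order w (\<lambda>i. fst (p i)) (\<lambda>i. snd (p i))"
    and iso: "order_iso_points (p ` S) (plot \<pi>)"
    using pin_sequence_iff[OF w] by blast
  have "inj_on (\<lambda>i. fst (p i)) S" using pin_order_inj(1)[OF p] S by (rule inj_on_subset)
  then have "draws \<pi> S (\<lambda>i. fst (p i)) (\<lambda>i. snd (p i))"
    using order_iso_points_plot_iff[OF \<pi>] iso by blast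
  then show "draws \<pi> S (xkey w) (ykey w)"
    by (rule draws_reindex[of _ _ _ _ id])
      (use pin_order_unique[OF pin_order_keys[OF w] p] S in \<open>auto simp: subset_iff\<close>)
next
  assume d: "draws \<pi> S (xkey w) (ykey w)"
  define p where "p i = (real_of_int (xkey w i), real_of_int (ykey w i))" for i
  have p: "pin_order w (\<lambda>i. fst (p i)) (\<lambda>i. snd (p i))"
    using pin_order_keys[OF w] by (simp add: pin_order_def p_def)
  have "inj_on (\<lambda>i. fst (p i)) S" using pin_order_inj(1)[OF p] S by (rule inj_on_subset)
  moreover have "draws \<pi> S (\<lambda>i. fst (p i)) (\<lambda>i. snd (p i))"
    using d by (rule draws_reindex[of _ _ _ _ id]) (auto simp: p_def)
  ultimately have "order_iso_points (p ` S) (plot \<pi>)"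
    using order_iso_points_plot_iff[OF draws_perm[OF d]] by blast
  then show "is_perm \<pi> \<and> (\<exists>p. pin_sequence w p \<and> order_iso_points (p ` S) (plot \<pi>))"
    using draws_perm[OF d] p pin_sequence_iff[OF w] by blast
qed

text \<open>Existence and uniqueness of the drawn permutation give meaning to the \<open>THE\<close>
  in \<open>psi_circ\<close> and \<open>psi_bullet\<close>.\<close>

lemma the_draws:
  assumes w: "pin_word w" and S: "S \<subseteq> {0..length w}"
  shows "draws (THE \<pi>. is_perm \<pi> \<and> (\<exists>p. pin_sequence w p \<and> order_iso_points (p ` S) (plot \<pi>)))
    S (xkey w) (ykey w)"
  unfolding pin_points_iff_draws[OF assms]
proof (rule theI')
  have fin: "finite S" using S finite_subset by blast
  moreover have "inj_on (xkey w) S" "inj_on (ykey w) S"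
    using pin_order_inj[OF pin_order_keys[OF w]] S by (meson inj_on_subset)+
  ultimately show "\<exists>!\<pi>. draws \<pi> S (xkey w) (ykey w)"
    using draws_exists draws_unique by metis
qed

lemma draws_psi_circ: "pin_word w \<Longrightarrow> draws (psi_circ w) {1..length w} (xkey w) (ykey w)"
  unfolding psi_circ_def by (rule the_draws) auto

lemma draws_psi_bullet: "pin_word w \<Longrightarrow> draws (psi_bullet w) {0..length w} (xkey w) (ykey w)"
  unfolding psi_bullet_def by (rule the_draws) auto

subsection \<open>Cutting a pin sequence into factors\<close>

lemma psi_circ_Nil: "psi_circ [] = []"
  using length_draws[OF draws_psi_circ[of "[]"]] by (simp add: pin_word_def)

lemma length_psi_bullet: "pin_word w \<Longrightarrow> length (psi_bullet w) = Suc (length w)"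
  using length_draws[OF draws_psi_bullet[of w]] by simp

text \<open>\<open>psi_bullet v\<close> has one entry more than \<open>v\<close> has letters, and
  \<open>\<boxplus>\<close> consumes one entry, so each word adds exactly its length.\<close>

lemma length_foldl_boxplus:
  assumes "\<forall>v\<in>set vs. pin_word v"
  shows "length (foldl (\<boxplus>) \<sigma> (map psi_bullet vs)) = length \<sigma> + sum_list (map length vs)"
  using assms
proof (induction vs arbitrary: \<sigma>)
  case (Cons v vs)
  then have "psi_bullet v \<noteq> []" using length_psi_bullet[of v] by auto
  then show ?case using Cons by (simp add: length_boxplus length_psi_bullet)
qed simp

text \<open>Passing from \<open>u\<close> to \<open>w\<close> adds \<open>length a\<close> to
  \<open>xkey\<close> and to the absolute value of \<open>ykey\<close> and keeps the sign. Index 0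
  is left out because no letter places it.\<close>

lemma key_less_factor:
  fixes a b u :: "pin list"
  assumes "i \<in> {1..length u}" "j \<in> {1..length u}"
  defines "w \<equiv> a @ u @ b"
  shows "xkey w (length a + i) < xkey w (length a + j) \<longleftrightarrow> xkey u i < xkey u j"
    "ykey w (length a + i) < ykey w (length a + j) \<longleftrightarrow> ykey u i < ykey u j"
    "0 < ykey w (length a + i) \<longleftrightarrow> 0 < ykey u i"
proof -
  have nth: "w ! (length a + k - 1) = u ! (k - 1)" if "k \<in> {1..length u}" for k
  proof -
    have "length a + k - 1 = length a + (k - 1)" "k - 1 < length u" using that by auto
    then show ?thesis by (simp add: w_def nth_append)
  qed
  show "xkey w (length a + i) < xkey w (length a + j) \<longleftrightarrow> xkey u i < xkey u j"
    "ykey w (length a + i) < ykey w (length a + j) \<longleftrightarrow> ykey u i < ykey u j"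
    "0 < ykey w (length a + i) \<longleftrightarrow> 0 < ykey u i"
    using nth[OF assms(1)] nth[OF assms(2)] assms(1,2) unfolding xkey_def ykey_def by auto
qed

text \<open>Index \<open>length a\<close> is missing from \<open>A\<close> and plays the origin of
  \<open>u\<close>. A gap thus lies between \<open>A\<close> and the pins of \<open>u\<close>, each
  of which sees \<open>A\<close> as one point in the place of that origin.\<close>

lemma draws_boxplus_factor:
  fixes a b u :: "pin list"
  defines "w \<equiv> a @ u @ b"
  assumes w: "pin_word w" and A: "A \<subseteq> {1..<length a}" and \<pi>: "draws \<pi> A (xkey w) (ykey w)"
  shows "draws (\<pi> \<boxplus> psi_bullet u) (A \<union> {length a + 1..length a + length u}) (xkey w) (ykey w)"
proof -
  let ?z = "length a" and ?B = "{length a + 1..length a + length u}"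
  let ?g = "\<lambda>i. i - length a"
  have u: "pin_word u" using pin_word_sublist[OF w] by (auto simp: w_def)
  have shift: "?z + ?g i = i" "?g i \<in> {1..length u}" if "i \<in> ?B" for i using that by auto
  have "bij_betw ?g (insert ?z ?B) {0..length u}"
    by (rule bij_betw_byWitness[where f' = "\<lambda>i. i + length a"]) auto
  then have \<tau>: "draws (psi_bullet u) (insert ?z ?B) (\<lambda>i. xkey u (?g i)) (\<lambda>i. ykey u (?g i))"
    by (rule draws_reindex[OF draws_psi_bullet[OF u]]) simp
  show ?thesis
  proof (rule draws_boxplus[OF \<pi> \<tau>])
    show "A \<inter> ?B = {}" "?z \<notin> ?B" using A by auto
    show "xkey u (?g ?z) < xkey u (?g i)" if "i \<in> ?B" for i using that by (simp add: xkey_def)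
    show "(xkey w i < xkey w j \<longleftrightarrow> xkey u (?g i) < xkey u (?g j)) \<and>
        (ykey w i < ykey w j \<longleftrightarrow> ykey u (?g i) < ykey u (?g j))" if "i \<in> ?B" "j \<in> ?B" for i j
      using key_less_factor(1,2)[OF shift(2)[OF that(1)] shift(2)[OF that(2)], of a b] shift(1) that
      unfolding w_def by metis
    show "xkey w i < xkey w j \<and> ykey w i \<noteq> ykey w j \<and>
        (ykey w i < ykey w j \<longleftrightarrow> ykey u (?g ?z) < ykey u (?g j))" if "i \<in> A" "j \<in> ?B" for i j
    proof -
      have "Suc i < j" "j \<le> length w" using that A by (auto simp: w_def)
      note gap = key_gap[OF w this]
      \<comment> \<open>By \<open>gap\<close> the later point is farther from the horizontal axis,
        so its sign alone decides which point is higher.\<close>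
      have "0 < ykey w j \<longleftrightarrow> 0 < ykey u (?g j)"
        using key_less_factor(3)[OF shift(2)[OF that(2)] shift(2)[OF that(2)], of a b] shift(1)[OF that(2)]
        unfolding w_def by metis
      moreover have "ykey u (?g ?z) = 0" by (simp add: ykey_def)
      ultimately show ?thesis using gap by auto
    qed
  qed auto
qed

lemma draws_psi_circ_factor:
  fixes a b u :: "pin list"
  defines "w \<equiv> a @ u @ b"
  assumes u: "pin_word u"
  shows "draws (psi_circ u) {length a + 1..length a + length u} (xkey w) (ykey w)"
proof (rule draws_reindex[OF draws_psi_circ[OF u]])
  show "bij_betw (\<lambda>i. i - length a) {length a + 1..length a + length u} {1..length u}"
    by (rule bij_betw_byWitness[where f' = "\<lambda>i. i + length a"]) auto
  fix i j assume "i \<in> {length a + 1..length a + length u}" "j \<in> {length a + 1..length a + length u}"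
  then have "i - length a \<in> {1..length u}" "j - length a \<in> {1..length u}"
    "length a + (i - length a) = i" "length a + (j - length a) = j" by auto
  then show "(xkey w i < xkey w j \<longleftrightarrow> xkey u (i - length a) < xkey u (j - length a)) \<and>
      (ykey w i < ykey w j \<longleftrightarrow> ykey u (i - length a) < ykey u (j - length a))"
    using key_less_factor(1,2) unfolding w_def by metis
qed

text \<open>Strong induction on the bound \<open>n\<close>: the last maximal run of \<open>T\<close>
  is split off as a \<open>psi_bullet\<close> summand. Starting the sum with the empty permutation
  spares a special case for the first run.\<close>

lemma draws_decompose:
  assumes w: "pin_word w" and "n \<le> length w" "T \<subseteq> {1..n}"
  shows "\<exists>vs. (\<forall>v\<in>set vs. sublist v w) \<and>
    draws (foldl (\<boxplus>) [] (map psi_bullet vs)) T (xkey w) (ykey w)"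
  using assms(2,3)
proof (induction n arbitrary: T rule: less_induct)
  case (less n)
  consider "T = {}" | "n \<notin> T" "T \<noteq> {}" | "n \<in> T" by blast
  then show ?case
  proof cases
    case 1
    then show ?thesis by (intro exI[of _ "[]"]) (auto simp: draws_def is_perm_def bij_betw_def)
  next
    case 2
    then have "n \<noteq> 0" using less.prems by auto
    moreover have "T \<subseteq> {1..n - 1}"
    proof
      fix x assume "x \<in> T"
      then have "1 \<le> x" "x \<le> n" "x \<noteq> n" using less.prems(2) 2(1) by auto
      then show "x \<in> {1..n - 1}" by simp
    qed
    ultimately show ?thesis using less.IH[of "n - 1" T] less.prems(1) by simp
  next
    case 3
    \<comment> \<open>The last index below \<open>n\<close> missing from \<open>T\<close>, hence the
      one just before the run ending in \<open>n\<close>; it exists because 0 is not in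
      \<open>T\<close>.\<close>
    define j where "j = Max {i. i < n \<and> i \<notin> T}"
    have n: "0 < n" using 3 less.prems by auto
    have "0 \<notin> T" using less.prems by auto
    then have "{i. i < n \<and> i \<notin> T} \<noteq> {}" using n by auto
    then have "j \<in> {i. i < n \<and> i \<notin> T}" unfolding j_def by (intro Max_in) auto
    then have j: "j < n" "j \<notin> T" by auto
    have above: "i \<in> T" if "j < i" "i \<le> n" for i
    proof (rule ccontr)
      assume "i \<notin> T"
      then have "i \<le> j" unfolding j_def using that 3 by (intro Max_ge) (auto simp: le_less)
      then show False using that by simp
    qed
    \<comment> \<open>The letter at list position \<open>i - 1\<close> places \<open>p i\<close>, so
      these letters place the points from \<open>j + 1\<close> to \<open>n\<close>.\<close>
    define u where "u = take (n - j) (drop j w)"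
    have u: "w = take j w @ u @ drop n w"
    proof -
      have drop: "drop n w = drop (n - j) (drop j w)" using j by simp
      show ?thesis unfolding u_def drop append_take_drop_id by simp
    qed
    have len: "length (take j w) = j" "length u = n - j" using j less.prems(1) by (auto simp: u_def)
    \<comment> \<open>As \<open>j\<close> is not in \<open>T\<close>, this is all of
      \<open>T\<close> before the run, with the gap that \<open>draws_boxplus_factor\<close>
      requires.\<close>
    let ?A = "T \<inter> {1..<j}"
    have "?A \<subseteq> {1..j - 1}" "j - 1 < n" "j - 1 \<le> length w" using j less.prems(1) by auto
    then obtain vs where vs: "\<forall>v\<in>set vs. sublist v w"
        "draws (foldl (\<boxplus>) [] (map psi_bullet vs)) ?A (xkey w) (ykey w)"
      using less.IH[of "j - 1" ?A] by blast
    have "draws (foldl (\<boxplus>) [] (map psi_bullet vs) \<boxplus> psi_bullet u) (?A \<union> {j + 1..j + (n - j)}) (xkey w) (ykey w)"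
      using draws_boxplus_factor[of "take j w" u "drop n w" ?A] vs(2) w unfolding len u[symmetric] by auto
    moreover have "?A \<union> {j + 1..j + (n - j)} = T"
    proof (intro equalityI subsetI)
      fix x assume "x \<in> T"
      then show "x \<in> ?A \<union> {j + 1..j + (n - j)}" using less.prems(2) j by (cases x j rule: linorder_cases) auto
    qed (use above j in auto)
    moreover have "sublist u w" using u unfolding sublist_def by blast
    ultimately show ?thesis using vs(1) by (intro exI[of _ "vs @ [u]"]) auto
  qed
qed

subsection \<open>Recurrence of factors\<close>

lemma word_power_Suc: "word_power x (Suc n) = x @ word_power x n"
  by (simp add: word_power_def)

lemma word_power_Suc_right: "word_power x (Suc n) = word_power x n @ x"
  by (simp add: word_power_def flip: replicate_append_same)

lemma complement_append: "complement (x @ y) = complement x @ complement y"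
  by (simp add: complement_def)

lemma complement_complement: "complement (complement x) = x"
  by (simp add: complement_def comp_def)

lemma alpha_Suc:
  assumes "s (Suc i) > 0"
  obtains y where "alpha s (Suc (Suc i)) = alpha s (Suc i) @ y @ complement (alpha s (Suc i))"
proof -
  obtain k where "s (Suc i) = Suc k" using assms gr0_implies_Suc by blast
  then have "alpha s (Suc (Suc i)) = alpha s (Suc i) @ (word_power (alpha s (Suc i)) k @
      word_power (complement (alpha s (Suc i))) k) @ complement (alpha s (Suc i))"
    by (simp add: word_power_Suc[of "alpha s (Suc i)"] word_power_Suc_right[of "complement (alpha s (Suc i))"])
  then show ?thesis by (rule that)
qed

lemma alpha_prefix:
  assumes "\<And>k. k \<ge> 1 \<Longrightarrow> s k > 0" "1 \<le> i" "i \<le> j"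
  shows "prefix (alpha s i) (alpha s j)"
  using assms(3)
proof (induction j rule: dec_induct)
  case (step n)
  then obtain m where "n = Suc m" using assms(2) by (cases n) auto
  then show ?case
    using step alpha_Suc[of s m] assms(1) by (metis le_add1 plus_1_eq_Suc prefix_append prefix_def)
qed simp

lemma alpha_nonempty:
  assumes "\<And>k. k \<ge> 1 \<Longrightarrow> s k > 0" "1 \<le> i"
  shows "alpha s i \<noteq> []"
  using alpha_prefix[of s 1 i] assms by auto

text \<open>\<open>alpha s (i + 2)\<close> ends in the complement of \<open>alpha s (i + 1)\<close>,
  which in turn ends in the double complement of \<open>alpha s i\<close>, that is, in
  \<open>alpha s i\<close> itself.\<close>

lemma alpha_recurs:
  assumes "\<And>k. k \<ge> 1 \<Longrightarrow> s k > 0" "1 \<le> i"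
  obtains y where "y \<noteq> []" "alpha s (i + 2) = alpha s i @ y @ alpha s i"
proof -
  obtain m where m: "i = Suc m" using assms(2) by (cases i) auto
  let ?a = "alpha s i" and ?a' = "alpha s (Suc i)"
  obtain y where y: "?a' = ?a @ y @ complement ?a"
    using alpha_Suc[of s m] assms(1) m by auto
  obtain z where "alpha s (i + 2) = ?a' @ z @ complement ?a'"
    using alpha_Suc[of s i] assms(1) by auto
  then have "alpha s (i + 2) = ?a @ (y @ complement ?a @ z @ complement ?a @ complement y) @ ?a"
    unfolding y by (simp add: complement_append complement_complement)
  moreover have "complement ?a \<noteq> []"
    using alpha_nonempty[of s i] assms by (simp add: complement_def)
  ultimately show ?thesis by (intro that) auto
qed

section \<open>Several factors inside one long word\<close>

lemma rho_append: "rho (x @ y) = rho x @ rho y"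
  by (simp add: rho_def)

lemma lang_P_iff: "v \<in> lang_P s \<longleftrightarrow> (\<exists>i\<ge>1. sublist v (rho (alpha s i)))"
proof
  assume "v \<in> lang_P s"
  then obtain x i where "i \<ge> 1" "sublist x (alpha s i)" "sublist v (rho x)"
    by (auto simp: lang_P_def lang_L_def)
  moreover from this have "sublist (rho x) (rho (alpha s i))"
    unfolding sublist_def[of x] by (auto simp: rho_append)
  ultimately show "\<exists>i\<ge>1. sublist v (rho (alpha s i))"
    using sublist_order.order.trans by blast
qed (auto simp: lang_P_def lang_L_def)

text \<open>A key looks only at the index and the letter placing it, so extending the word on the
  right moves no point.\<close>

lemma key_append:
  assumes "i \<le> length w"
  shows "xkey (w @ w') i = xkey w i" "ykey (w @ w') i = ykey w i"
proof -
  have "(w @ w') ! (i - 1) = w ! (i - 1)" if "0 < i" using assms that by (auto simp: nth_append)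
  then show "xkey (w @ w') i = xkey w i" "ykey (w @ w') i = ykey w i"
    by (simp_all add: xkey_def ykey_def)
qed

text \<open>Induction on the number of summands: the points found so far stay in an initial part of
  a longer word, and a later copy of \<open>alpha s k\<close> hosts the next summand.\<close>

lemma draws_embed:
  assumes s: "\<And>k. k \<ge> 1 \<Longrightarrow> s k > 0" and v: "v \<in> lang_P s" and "set vs \<subseteq> lang_P s"
  shows "\<exists>i\<ge>1. \<exists>T\<subseteq>{1..length (rho (alpha s i))}.
    draws (foldl (\<boxplus>) (psi_circ v) (map psi_bullet vs)) T
      (xkey (rho (alpha s i))) (ykey (rho (alpha s i)))"
  using assms(3)
proof (induction vs rule: rev_induct)
  case Nil
  obtain i a b where i: "i \<ge> 1" "rho (alpha s i) = a @ v @ b"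
    using v unfolding lang_P_iff sublist_def by blast
  then have "draws (psi_circ v) {length a + 1..length a + length v} (xkey (rho (alpha s i))) (ykey (rho (alpha s i)))"
    using draws_psi_circ_factor[OF pin_word_lang_P[OF v]] by simp
  moreover have "{length a + 1..length a + length v} \<subseteq> {1..length (rho (alpha s i))}"
    using i by auto
  ultimately show ?case unfolding list.map foldl_Nil using i(1) by blast
next
  case (snoc u vs)
  let ?\<pi> = "foldl (\<boxplus>) (psi_circ v) (map psi_bullet vs)"
  obtain i T where i: "i \<ge> 1" and T: "T \<subseteq> {1..length (rho (alpha s i))}"
    and d: "draws ?\<pi> T (xkey (rho (alpha s i))) (ykey (rho (alpha s i)))"
    using snoc by auto
  have "u \<in> lang_P s" using snoc.prems by simp
  then obtain j where j: "j \<ge> 1" "sublist u (rho (alpha s j))"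
    unfolding lang_P_iff by blast
  \<comment> \<open>A common level: \<open>alpha s i\<close>, which carries the earlier points, and
    \<open>alpha s j\<close>, which hosts \<open>u\<close>, are both prefixes of
    \<open>alpha s k\<close>.\<close>
  define k where "k = max i j"
  have k: "1 \<le> k" "i \<le> k" "j \<le> k" using i by (auto simp: k_def)
  obtain y where y: "y \<noteq> []" "alpha s (k + 2) = alpha s k @ y @ alpha s k"
    by (rule alpha_recurs[of s k]) (use s k(1) in auto)
  obtain c where c: "alpha s k = alpha s i @ c"
    using alpha_prefix[of s i k] s i k(2) by (auto simp: prefix_def)
  obtain c' where c': "alpha s k = alpha s j @ c'"
    using alpha_prefix[of s j k] s j(1) k(3) by (auto simp: prefix_def)
  obtain a b where ab: "rho (alpha s k) = a @ u @ b"
    using j(2) unfolding c' rho_append sublist_def by auto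
  let ?w = "rho (alpha s (k + 2))"
  \<comment> \<open>All that precedes \<open>u\<close> in the second copy of
    \<open>alpha s k\<close>; the nonempty \<open>y\<close> guarantees a skipped index after
    \<open>T\<close>.\<close>
  let ?a = "rho (alpha s k) @ rho y @ a"
  have w: "?w = ?a @ u @ b" unfolding y(2) rho_append ab by simp
  have "rho y \<noteq> []" using y(1) by (cases y) (auto simp: rho_def)
  then have "0 < length (rho y)" by simp
  then have lt: "length (rho (alpha s i)) < length ?a"
    unfolding c rho_append length_append by linarith
  have "draws ?\<pi> T (xkey ?w) (ykey ?w)"
  proof (rule draws_cong[OF d])
    fix x assume "x \<in> T"
    then have "x \<le> length (rho (alpha s i))" using T by auto
    moreover have "?w = rho (alpha s i) @ rho (c @ y @ alpha s k)"
      unfolding y(2) rho_append[symmetric] by (simp add: c)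
    ultimately show "xkey ?w x = xkey (rho (alpha s i)) x \<and> ykey ?w x = ykey (rho (alpha s i)) x"
      by (simp only: key_append)
  qed
  moreover have "T \<subseteq> {1..<length ?a}" using T lt by force
  ultimately have "draws (?\<pi> \<boxplus> psi_bullet u) (T \<union> {length ?a + 1..length ?a + length u}) (xkey ?w) (ykey ?w)"
    using draws_boxplus_factor[of ?a u b T ?\<pi>] pin_word_rho unfolding w[symmetric] by blast
  moreover have "T \<union> {length ?a + 1..length ?a + length u} \<subseteq> {1..length ?w}"
  proof -
    have "length ?w = length ?a + length u + length b" unfolding w by simp
    then show ?thesis using T lt by force
  qed
  moreover have "1 \<le> k + 2" by simp
  ultimately show ?case unfolding map_append foldl_append list.map foldl_Cons foldl_Nil by blast
qed

section \<open>Equality of the class with the set of sums\<close>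

theorem theorem5p2:
  fixes s :: "nat \<Rightarrow> nat"
  assumes "\<And>k. k \<ge> 1 \<Longrightarrow> s k > 0"
  shows "class_C s =
    {\<pi>. is_perm \<pi> \<and>
        (\<exists>v vs. v \<in> lang_P s \<and> set vs \<subseteq> lang_P s \<and>
           length v + sum_list (map length vs) = length \<pi> \<and>
           \<pi> = foldl (\<boxplus>) (psi_circ v) (map psi_bullet vs))}"
proof (intro equalityI subsetI CollectI)
  fix \<pi> assume "\<pi> \<in> class_C s"
  then obtain w where \<pi>: "is_perm \<pi>" and w: "w \<in> lang_P s" and "contains (psi_circ w) \<pi>"
    by (auto simp: class_C_def)
  note pw = pin_word_lang_P[OF w]
  obtain T where T: "T \<subseteq> {1..length w}" and d: "draws \<pi> T (xkey w) (ykey w)"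
    using contains_iff_draws[OF draws_psi_circ[OF pw] \<pi>] \<open>contains _ _\<close> by blast
  obtain vs where vs: "\<forall>v\<in>set vs. sublist v w"
    and d': "draws (foldl (\<boxplus>) [] (map psi_bullet vs)) T (xkey w) (ykey w)"
    using draws_decompose[OF pw order.refl T] by blast
  \<comment> \<open>Both permutations are drawn on \<open>T\<close> by the same keys.\<close>
  have eq: "\<pi> = foldl (\<boxplus>) [] (map psi_bullet vs)"
    using d d' finite_subset[OF T] by (intro draws_unique) auto
  have P: "v \<in> lang_P s" if "sublist v w" for v
    using w that sublist_order.order.trans unfolding lang_P_iff by blast
  \<comment> \<open>The empty word is the choice for \<open>v\<close>: \<open>psi_circ []\<close> is
    the empty permutation with which the sum of \<open>draws_decompose\<close> starts.\<close>
  then have "set vs \<subseteq> lang_P s" "[] \<in> lang_P s" using vs by auto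
  moreover have "length \<pi> = sum_list (map length vs)"
    using length_foldl_boxplus[of vs "[]"] vs pin_word_sublist[OF pw] eq by simp
  ultimately show "is_perm \<pi> \<and> (\<exists>v vs. v \<in> lang_P s \<and> set vs \<subseteq> lang_P s \<and>
           length v + sum_list (map length vs) = length \<pi> \<and>
           \<pi> = foldl (\<boxplus>) (psi_circ v) (map psi_bullet vs))"
    using \<pi> eq by (intro conjI exI[of _ "[]"] exI[of _ vs]) (auto simp: psi_circ_Nil)
next
  fix \<pi> assume "\<pi> \<in> {\<pi>. is_perm \<pi> \<and>
        (\<exists>v vs. v \<in> lang_P s \<and> set vs \<subseteq> lang_P s \<and>
           length v + sum_list (map length vs) = length \<pi> \<and>
           \<pi> = foldl (\<boxplus>) (psi_circ v) (map psi_bullet vs))}"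
  then obtain v vs where \<pi>: "is_perm \<pi>" and v: "v \<in> lang_P s" "set vs \<subseteq> lang_P s"
    and eq: "\<pi> = foldl (\<boxplus>) (psi_circ v) (map psi_bullet vs)" by blast
  obtain i T where i: "i \<ge> 1" and T: "T \<subseteq> {1..length (rho (alpha s i))}"
    and d: "draws \<pi> T (xkey (rho (alpha s i))) (ykey (rho (alpha s i)))"
    using draws_embed[of s v vs] assms v unfolding eq by blast
  have "contains (psi_circ (rho (alpha s i))) \<pi>"
    using contains_iff_draws[OF draws_psi_circ[OF pin_word_rho] \<pi>] T d by blast
  moreover have "rho (alpha s i) \<in> lang_P s" using i lang_P_iff by auto
  ultimately show "\<pi> \<in> class_C s" using \<pi> by (auto simp: class_C_def)
qed

end
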